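(* For all constants $\varepsilon>0$ and $K>0$ there exist constants $\gamma,\alpha>0$ and $n_0$ such that for all $n\geq n_0$ the following holds. Let $k\geq 2$ and $h\geq1$ be integers with $k/h\leq K\, n^{1/4-\varepsilon}$, and let $\mathbf{c}=(c_1,\dots,c_k)$ be an initial $k$-color configuration on $n$ nodes with $\max\{c_j : j=1,\dots,k\}\leq \frac{3n}{2k}$. Let $\mathbf{C}^{(t)}$ be the random configuration at round $t$ of the $h$-plurality protocol started from $\mathbf{C}^{(0)}=\mathbf{c}$, and let $\tau=\inf\{t\in\mathbb{N}: \mathbf{C}^{(t)}\text{ is monochromatic}\}$. Then $\tau\geq\gamma\,k/h^2$ with probability at least $1-n^{-\alpha}$. (That is, $\tau=\Omega(k/h^2)$ with high probability.)
   Context: A $k$-color configuration on $n$ nodes is a $k$-tuple $\mathbf{c}=(c_1,\dots,c_k)$ of non-negative integers with $\sum_{j} c_j = n$, where $c_j$ is the number of nodes with color $j\in[k]=\{1,\dots,k\}$. It is monochromatic if $c_j=n$ for some $j\in[k]$. $h$-plurality protocol (synchronous rounds): at every round, every node, independently of the others, picks $h$ nodes uniformly at random (including itself and with repetitions) and recolors itself according to the plurality of the colors it sees, breaking ties uniformly at random. All nodes update simultaneously, using the colors at the beginning of the round. *)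

theory Defs
  imports "HOL-Probability.Probability"
begin

text \<open>
  Configurations are functions on colors of which only the values on \<open>{1..k}\<close> are used.
  A coloring of \<open>n\<close> nodes is a list of length \<open>n\<close>: node \<open>v < n\<close> has color \<open>x ! v\<close>, and the
  configuration it induces is \<^term>\<open>count_list x\<close>.
\<close>

definition is_configuration :: "nat \<Rightarrow> nat \<Rightarrow> (nat \<Rightarrow> nat) \<Rightarrow> bool" where
  "is_configuration k n c \<longleftrightarrow> (\<Sum>j\<in>{1..k}. c j) = n"

definition monochromatic :: "nat \<Rightarrow> nat \<Rightarrow> (nat \<Rightarrow> nat) \<Rightarrow> bool" where
  "monochromatic k n c \<longleftrightarrow> (\<exists>j\<in>{1..k}. c j = n)"

definition realizes :: "nat \<Rightarrow> nat list \<Rightarrow> (nat \<Rightarrow> nat) \<Rightarrow> bool" where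
  "realizes k x c \<longleftrightarrow> set x \<subseteq> {1..k} \<and> (\<forall>j\<in>{1..k}. count_list x j = c j)"

definition plurality_colors :: "nat list \<Rightarrow> nat set" where
  "plurality_colors s = {j \<in> set s. \<forall>i\<in>set s. count_list s i \<le> count_list s j}"

definition node_update :: "nat \<Rightarrow> nat list \<Rightarrow> nat pmf" where
  "node_update h x = do {
     vs \<leftarrow> replicate_pmf h (pmf_of_set {..<length x});
     pmf_of_set (plurality_colors (map (\<lambda>v. x ! v) vs))
   }"

text \<open>
  The new color of a node has the same law for every node, because a node samples from all nodes,
  itself included. The independent updates of all nodes are therefore independent and identically
  distributed draws, the \<open>v\<close>-th of which is the new color of node \<open>v\<close>.
\<close>

definition plurality_round :: "nat \<Rightarrow> nat list \<Rightarrow> nat list pmf" where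
  "plurality_round h x = replicate_pmf (length x) (node_update h x)"

text \<open>
  Law of the coloring in round \<open>t\<close> given the colorings of all earlier rounds.
\<close>

definition plurality_kernel :: "nat \<Rightarrow> nat list \<Rightarrow> nat \<Rightarrow> (nat \<Rightarrow> nat list) \<Rightarrow> nat list measure" where
  "plurality_kernel h x t \<omega> =
     measure_pmf (case t of 0 \<Rightarrow> return_pmf x | Suc s \<Rightarrow> plurality_round h (\<omega> s))"

lemma Ionescu_Tulcea_plurality_kernel:
  "Ionescu_Tulcea (plurality_kernel h x) (\<lambda>_. count_space UNIV)"
proof (rule Ionescu_Tulcea.intro)
  show "plurality_kernel h x t
      \<in> (\<Pi>\<^sub>M i\<in>{0..<t}. count_space UNIV) \<rightarrow>\<^sub>M subprob_algebra (count_space UNIV)" for t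
  proof (cases t)
    case 0
    then show ?thesis
      by (simp add: plurality_kernel_def[abs_def] measure_pmf_in_subprob_algebra)
  next
    case (Suc s)
    have "(\<lambda>\<omega>. \<omega> s) \<in> (\<Pi>\<^sub>M i\<in>{0..<Suc s}. count_space UNIV) \<rightarrow>\<^sub>M count_space (UNIV :: nat list set)"
      by (rule measurable_component_singleton) simp
    moreover have "(\<lambda>y. measure_pmf (plurality_round h y))
        \<in> count_space UNIV \<rightarrow>\<^sub>M subprob_algebra (count_space UNIV)"
      by (auto simp: measurable_def measure_pmf_in_subprob_algebra)
    ultimately show ?thesis
      unfolding Suc plurality_kernel_def[abs_def] nat.case by (rule measurable_compose)
  qed
  show "prob_space (plurality_kernel h x t \<omega>)"
    if "\<omega> \<in> space (\<Pi>\<^sub>M i\<in>{0..<t}. count_space UNIV)" for t \<omega>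
    by (simp add: plurality_kernel_def measure_pmf.prob_space_axioms)
qed

text \<open>
  The law of the whole trajectory of colorings started from \<open>x\<close>, on the product \<open>\<sigma>\<close>-algebra; the
  lemmas below state that it is a probability measure with the expected path probabilities.
\<close>

definition plurality_process :: "nat \<Rightarrow> nat list \<Rightarrow> (nat \<Rightarrow> nat list) measure" where
  "plurality_process h x =
     projective_family.lim UNIV
       (Ionescu_Tulcea.CI (plurality_kernel h x) (\<lambda>_. count_space UNIV)) (\<lambda>_. count_space UNIV)"

definition consensus_time :: "nat \<Rightarrow> nat \<Rightarrow> (nat \<Rightarrow> nat list) \<Rightarrow> enat" where
  "consensus_time k n \<omega> = Inf {enat t | t. monochromatic k n (count_list (\<omega> t))}"

lemma sets_plurality_process [measurable_cong]:
  "sets (plurality_process h x) = sets (\<Pi>\<^sub>M t\<in>UNIV. count_space UNIV)"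
proof -
  interpret Ionescu_Tulcea "plurality_kernel h x" "\<lambda>_. count_space UNIV"
    by (rule Ionescu_Tulcea_plurality_kernel)
  show ?thesis unfolding plurality_process_def by (rule PF.sets_lim)
qed

lemma space_plurality_process [simp]: "space (plurality_process h x) = UNIV"
  using sets_eq_imp_space_eq[OF sets_plurality_process] by (simp add: space_PiM)

lemma prob_space_plurality_process: "prob_space (plurality_process h x)"
proof -
  interpret Ionescu_Tulcea "plurality_kernel h x" "\<lambda>_. count_space UNIV"
    by (rule Ionescu_Tulcea_plurality_kernel)
  have "prob_space (distr (plurality_process h x) (\<Pi>\<^sub>M t\<in>{}. count_space UNIV)
      (\<lambda>\<omega>. restrict \<omega> {}))"
    unfolding plurality_process_def by (simp add: distr_lim PF.prob_space_P)
  then show ?thesis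
    by (rule prob_space_distrD[rotated]) (auto intro!: measurable_restrict)
qed

lemma sets_plurality_path:
  "{\<omega>. \<forall>s<t. \<omega> s = y s} \<in> sets (plurality_process h x)"
proof -
  have "{\<omega> \<in> space (plurality_process h x). \<forall>s<t. \<omega> s = y s} \<in> sets (plurality_process h x)"
    by measurable
  then show ?thesis by simp
qed

lemma emeasure_plurality_process_path:
  "emeasure (plurality_process h x) {\<omega>. \<forall>s<t. \<omega> s = y s} =
     (\<Prod>s<t. emeasure (plurality_kernel h x s y) {y s})"
proof -
  interpret Ionescu_Tulcea "plurality_kernel h x" "\<lambda>_. count_space UNIV"
    by (rule Ionescu_Tulcea_plurality_kernel)
  let ?M = "\<lambda>t. \<Pi>\<^sub>M i\<in>{0..<t}. count_space (UNIV :: nat list set)"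
  let ?S = "\<lambda>t. {\<omega> \<in> space (?M t). \<forall>s<t. \<omega> s = y s}"
  have S [measurable]: "?S t \<in> sets (?M t)" for t
  proof -
    have "?S t = (\<Pi>\<^sub>E s\<in>{0..<t}. {y s})"
      by (auto simp: space_PiM PiE_iff extensional_def)
    then show ?thesis by (simp add: sets_PiM_I_finite)
  qed
  have C: "emeasure (C 0 t (\<lambda>_. undefined)) (?S t) =
      (\<Prod>s<t. emeasure (plurality_kernel h x s y) {y s})" for t
  proof (induction t)
    case 0
    show ?case using S[of 0] by (simp add: space_PiM emeasure_return)
  next
    case (Suc t)
    have sp: "space (C 0 t (\<lambda>_. undefined)) = space (?M t)"
      using space_C[of "\<lambda>_. undefined" 0 t] by (simp add: space_PiM)
    have sC: "sets (C 0 t (\<lambda>_. undefined)) = sets (?M t)"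
      using sets_C[of "\<lambda>_. undefined" 0 t] by (simp add: space_PiM)
    have step: "emeasure (eP t \<omega>) (?S (Suc t)) =
        emeasure (plurality_kernel h x t y) {y t} * indicator (?S t) \<omega>"
      if \<omega>: "\<omega> \<in> space (?M t)" for \<omega>
    proof -
      have "emeasure (eP t \<omega>) (?S (Suc t)) = emeasure (plurality_kernel h x t \<omega>)
          ((\<lambda>z. fun_upd \<omega> t z) -` ?S (Suc t) \<inter> space (count_space UNIV))"
        by (rule emeasure_eP[OF \<omega> S])
      also have "(\<lambda>z. fun_upd \<omega> t z) -` ?S (Suc t) \<inter> space (count_space UNIV) =
          (if \<omega> \<in> ?S t then {y t} else {})"
        using \<omega> by (auto simp: space_PiM PiE_iff extensional_def less_Suc_eq)
      also have "emeasure (plurality_kernel h x t \<omega>) \<dots> =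
          emeasure (plurality_kernel h x t y) {y t} * indicator (?S t) \<omega>"
        by (cases t) (auto simp: plurality_kernel_def)
      finally show ?thesis .
    qed
    have "emeasure (C 0 (Suc t) (\<lambda>_. undefined)) (?S (Suc t)) =
        (\<integral>\<^sup>+\<omega>. emeasure (eP t \<omega>) (?S (Suc t)) \<partial>C 0 t (\<lambda>_. undefined))"
      using measurable_eP[of t]
      by (simp only: C.simps add_0, subst emeasure_bind[OF _ _ S])
         (auto simp: sp measurable_cong_sets[OF sC refl] space_PiM)
    also have "\<dots> = (\<integral>\<^sup>+\<omega>. emeasure (plurality_kernel h x t y) {y t} * indicator (?S t) \<omega>
        \<partial>C 0 t (\<lambda>_. undefined))"
      by (intro nn_integral_cong step) (simp add: sp)
    also have "\<dots> = emeasure (plurality_kernel h x t y) {y t} *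
        emeasure (C 0 t (\<lambda>_. undefined)) (?S t)"
      by (rule nn_integral_cmult_indicator) (simp add: sC S)
    finally show ?case using Suc.IH by (simp add: mult.commute)
  qed
  have "{\<omega>. \<forall>s<t. \<omega> s = y s} = PF.emb UNIV {0..<t} (?S t)"
    by (auto simp: prod_emb_def space_PiM PiE_iff)
  then have "emeasure (plurality_process h x) {\<omega>. \<forall>s<t. \<omega> s = y s} = emeasure (CI {0..<t}) (?S t)"
    unfolding plurality_process_def by (simp only: lim[OF _ S] finite_atLeastLessThan)
  also have "\<dots> = emeasure (C 0 t (\<lambda>_. undefined)) (PF.emb {0..<t} {0..<t} (?S t))"
    by (rule emeasure_CI) (use S in auto)
  also have "PF.emb {0..<t} {0..<t} (?S t) = ?S t"
    by (rule prod_emb_id) (auto simp: space_PiM)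
  also note C
  finally show ?thesis .
qed

lemma measure_plurality_process_path:
  "measure (plurality_process h x) {\<omega>. \<forall>s\<le>t. \<omega> s = y s} =
     (if y 0 = x then \<Prod>s<t. pmf (plurality_round h (y s)) (y (Suc s)) else 0)"
proof -
  have "emeasure (plurality_process h x) {\<omega>. \<forall>s\<le>t. \<omega> s = y s} =
      (\<Prod>s<Suc t. ennreal (pmf (case s of 0 \<Rightarrow> return_pmf x | Suc r \<Rightarrow> plurality_round h (y r)) (y s)))"
    using emeasure_plurality_process_path[of h x "Suc t" y]
    by (simp add: plurality_kernel_def emeasure_pmf_single less_Suc_eq_le)
  also have "\<dots> = ennreal
      (\<Prod>s<Suc t. pmf (case s of 0 \<Rightarrow> return_pmf x | Suc r \<Rightarrow> plurality_round h (y r)) (y s))"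
    by (rule prod_ennreal) simp
  also have "(\<Prod>s<Suc t. pmf (case s of 0 \<Rightarrow> return_pmf x | Suc r \<Rightarrow> plurality_round h (y r)) (y s)) =
      (if y 0 = x then \<Prod>s<t. pmf (plurality_round h (y s)) (y (Suc s)) else 0)"
    by (subst prod.lessThan_Suc_shift) (auto simp: pmf_return)
  finally show ?thesis by (simp add: measure_def prod_nonneg)
qed

lemma sets_consensus_time_ge:
  "{\<omega>. a \<le> ereal_of_enat (consensus_time k n \<omega>)} \<in> sets (plurality_process h x)"
proof -
  have *: "a \<le> ereal_of_enat (consensus_time k n \<omega>) \<longleftrightarrow>
      (\<forall>t. monochromatic k n (count_list (\<omega> t)) \<longrightarrow> a \<le> ereal (real t))" for \<omega>
  proof (cases "\<exists>t. monochromatic k n (count_list (\<omega> t))")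
    case True
    define S where "S = {enat t | t. monochromatic k n (count_list (\<omega> t))}"
    obtain t0 where "enat t0 \<in> S" using True by (auto simp: S_def)
    then have "Inf S \<in> S"
      unfolding Inf_enat_def using LeastI[of "\<lambda>e. e \<in> S"] by auto
    then obtain t where t: "Inf S = enat t" "monochromatic k n (count_list (\<omega> t))"
      by (auto simp: S_def)
    have "t \<le> t'" if "monochromatic k n (count_list (\<omega> t'))" for t'
      using Inf_lower[of "enat t'" S] that t(1) by (auto simp: S_def)
    then show ?thesis
      unfolding consensus_time_def S_def[symmetric] t(1)
      using t(2) by (auto intro: order_trans)
  next
    case False
    then have "consensus_time k n \<omega> = \<infinity>"
      by (simp add: consensus_time_def Inf_enat_def)
    then show ?thesis using False by simp
  qed
  have "{\<omega> \<in> space (plurality_process h x). a \<le> ereal_of_enat (consensus_time k n \<omega>)}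
      \<in> sets (plurality_process h x)"
    unfolding * by measurable
  then show ?thesis by simp
qed

end

theory Submission
  imports Defs "HOL-Real_Asymp.Real_Asymp"
begin

text \<open>
  A node seeing \<open>X\<close> copies of color \<open>j\<close> adopts \<open>j\<close> with probability at most \<open>X / h + (X choose 2)\<close>.
  Hence, if a fraction \<open>p\<close> of the nodes has color \<open>j\<close>, the next fraction has expectation at most
  \<open>p + h\<^sup>2 p\<^sup>2 / 2\<close>, so as long as \<open>p \<le> 2 / k\<close> it drifts upwards by at most \<open>2 h\<^sup>2 / k\<^sup>2\<close> per round. By
  Hoeffding's inequality the fluctuation exceeds \<open>h\<^sup>2 / k\<^sup>2\<close> only with probability
  \<open>exp (- 2 n h\<^sup>4 / k\<^sup>4)\<close>, which is superpolynomially small by the assumption on \<open>k / h\<close>. A union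
  bound over the \<open>k\<close> colors and the first \<open>k / (12 h\<^sup>2)\<close> rounds keeps all fractions at most
  \<open>3 / (2 k) + 3 / (12 k) = 7 / (4 k) < 1\<close>.
\<close>

section \<open>Counts of one color among independent draws: binomial law, tail bound and
  moments\<close>

lemma map_pmf_eq_bernoulli: "map_pmf (\<lambda>a. a = j) D = bernoulli_pmf (pmf D j)"
proof (rule pmf_eqI)
  fix b
  have 1: "measure_pmf.prob D {x. x = j} = pmf D j"
    by (simp add: measure_pmf_single)
  have "measure_pmf.prob D {x. x \<noteq> j} = 1 - measure_pmf.prob D {x. x = j}"
    using measure_pmf.prob_compl[of "{x. x = j}" D] by (simp add: Compl_eq_Diff_UNIV[symmetric] Collect_neg_eq)
  with 1 show "pmf (map_pmf (\<lambda>a. a = j) D) b = pmf (bernoulli_pmf (pmf D j)) b"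
    by (cases b) (simp_all add: pmf_map vimage_def pmf_le_1)
qed

text \<open>Each draw is a Bernoulli trial for the event of hitting \<open>j\<close>; this opens the
  way to tail bounds for the binomial distribution.\<close>

lemma map_count_list_replicate_pmf:
  "map_pmf (\<lambda>z. count_list z j) (replicate_pmf n D) = binomial_pmf n (pmf D j)"
proof (induction n)
  case 0
  then show ?case by (simp add: binomial_pmf_0 pmf_le_1)
next
  case (Suc n)
  have "binomial_pmf (Suc n) (pmf D j) =
      bind_pmf (map_pmf (\<lambda>a. a = j) D) (\<lambda>b.
        bind_pmf (map_pmf (\<lambda>z. count_list z j) (replicate_pmf n D)) (\<lambda>k.
          return_pmf ((if b then 1 else 0) + k)))"
    by (simp add: binomial_pmf_Suc pmf_le_1 Suc.IH map_pmf_eq_bernoulli)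
  then show ?case
    by (auto simp: map_pmf_def bind_assoc_pmf bind_return_pmf intro!: bind_pmf_cong)
qed

text \<open>Hoeffding's inequality for the binomial count, with the deviation \<open>d\<close>
  measured on fractions rather than counts.\<close>

lemma prob_count_list_replicate_pmf_ge:
  assumes "0 \<le> d" "0 < n"
  shows "measure_pmf.prob (replicate_pmf n D) {z. real n * (pmf D j + d) \<le> real (count_list z j)}
    \<le> exp (- 2 * real n * d\<^sup>2)"
proof -
  interpret binomial_distribution n "pmf D j"
    by unfold_locales (simp add: pmf_le_1)
  have "measure_pmf.prob (replicate_pmf n D) {z. real n * (pmf D j + d) \<le> real (count_list z j)} =
      measure_pmf.prob (binomial_pmf n (pmf D j)) {m. pmf D j + d \<le> real m / real n}"
    using assms(2)
    by (simp add: map_count_list_replicate_pmf[symmetric] vimage_def pos_le_divide_eq mult.commute)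
  also have "\<dots> \<le> exp (- 2 * real n * d\<^sup>2)"
    using prob_ge'[OF assms(2,1)] by simp
  finally show ?thesis .
qed

text \<open>Linearity of expectation, one draw at a time. Integrals in \<open>ennreal\<close> spare
  all integrability conditions.\<close>

lemma nn_integral_count_list_replicate_pmf:
  "(\<integral>\<^sup>+s. of_nat (count_list s j) \<partial>replicate_pmf h D) = of_nat h * ennreal (pmf D j)"
proof (induction h)
  case (Suc h)
  have "(\<integral>\<^sup>+s. of_nat (count_list s j) \<partial>replicate_pmf (Suc h) D) =
      (\<integral>\<^sup>+a. \<integral>\<^sup>+s. indicator {j} a + of_nat (count_list s j) \<partial>replicate_pmf h D \<partial>D)"
    by (simp del: map_pmf_def) (intro nn_integral_cong, simp add: indicator_def)
  also have "\<dots> = ennreal (pmf D j) + of_nat h * ennreal (pmf D j)"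
    by (simp add: nn_integral_add Suc.IH emeasure_pmf_single)
  finally show ?case by (simp add: algebra_simps)
qed simp

text \<open>Each of the \<open>h choose 2\<close> pairs of draws shows \<open>j\<close> twice with
  probability \<open>(pmf D j)\<^sup>2\<close>. The induction uses Pascal's rule: a further draw of
  \<open>j\<close> forms one new pair with every earlier occurrence of \<open>j\<close>.\<close>

lemma nn_integral_count_list_choose_2_replicate_pmf:
  "(\<integral>\<^sup>+s. of_nat (count_list s j choose 2) \<partial>replicate_pmf h D) =
    of_nat (h choose 2) * ennreal ((pmf D j)\<^sup>2)"
proof (induction h)
  case (Suc h)
  have "(\<integral>\<^sup>+s. of_nat (count_list s j choose 2) \<partial>replicate_pmf (Suc h) D) =
      (\<integral>\<^sup>+a. \<integral>\<^sup>+s. indicator {j} a * of_nat (count_list s j) + of_nat (count_list s j choose 2)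
        \<partial>replicate_pmf h D \<partial>D)"
    by simp (intro nn_integral_cong, simp add: indicator_def numeral_2_eq_2)
  also have "\<dots> = ennreal (pmf D j) * (of_nat h * ennreal (pmf D j)) +
      of_nat (h choose 2) * ennreal ((pmf D j)\<^sup>2)"
    by (simp add: nn_integral_add nn_integral_cmult nn_integral_multc Suc.IH
        nn_integral_count_list_replicate_pmf emeasure_pmf_single)
  also have "\<dots> = of_nat (Suc h choose 2) * ennreal ((pmf D j)\<^sup>2)"
    by (simp add: numeral_2_eq_2 ennreal_mult power2_eq_square algebra_simps)
  finally show ?case .
qed (simp add: numeral_2_eq_2)

section \<open>The plurality rule and the law of the new color of a node\<close>

lemma plurality_colors_nonempty:
  assumes "s \<noteq> []"
  shows "plurality_colors s \<noteq> {}"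
proof -
  obtain j where "j \<in> set s" "Max (count_list s ` set s) = count_list s j"
    using Max_in[of "count_list s ` set s"] assms by blast
  moreover have "count_list s i \<le> Max (count_list s ` set s)" if "i \<in> set s" for i
    using that by (intro Max_ge) simp_all
  ultimately have "j \<in> plurality_colors s"
    by (simp add: plurality_colors_def)
  then show ?thesis by blast
qed

lemma finite_plurality_colors [simp]: "finite (plurality_colors s)"
  by (rule finite_subset[of _ "set s"]) (auto simp: plurality_colors_def)

text \<open>
  A color seen exactly once can only win if all colors seen are distinct, and then it wins with
  probability \<open>1 / h\<close>.
\<close>

lemma pmf_plurality_colors_le:
  assumes "s \<noteq> []"
  shows "pmf (pmf_of_set (plurality_colors s)) j
    \<le> real (count_list s j) / real (length s) + real (count_list s j choose 2)"
proof -
  have p: "pmf (pmf_of_set (plurality_colors s)) j =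
      indicator (plurality_colors s) j / real (card (plurality_colors s))"
    using plurality_colors_nonempty[OF assms] by simp
  show ?thesis
  proof (cases "j \<in> plurality_colors s")
    case False
    then show ?thesis using p by simp
  next
    case j: True
    then have pos: "count_list s j \<noteq> 0"
      by (simp add: plurality_colors_def count_list_0_iff)
    show ?thesis
    proof (cases "count_list s j = 1")
      case once: True
      have one: "count_list s i = 1" if i: "i \<in> set s" for i
      proof -
        have "count_list s i \<le> count_list s j"
          using j i unfolding plurality_colors_def by blast
        moreover have "count_list s i \<noteq> 0"
          using i by (simp add: count_list_0_iff)
        ultimately show ?thesis using once by linarith
      qed
      have set: "plurality_colors s = set s"
        by (rule set_eqI) (simp add: plurality_colors_def one cong: conj_cong)
      have "length s = sum (count_list s) (set s)"
        by (simp add: sum_count_set)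
      also have "\<dots> = (\<Sum>i\<in>set s. 1)"
        by (rule sum.cong) (rule refl, rule one)
      finally have card: "card (set s) = length s" by simp
      have "pmf (pmf_of_set (plurality_colors s)) j = 1 / real (length s)"
        unfolding p card[symmetric] set[symmetric] using j by simp
      then show ?thesis
        unfolding once by simp
    next
      case False
      \<comment> \<open>Two occurrences make the binomial coefficient at least 1, which bounds any
        probability.\<close>
      with pos have "2 \<le> count_list s j" by linarith
      then have "1 \<le> count_list s j choose 2"
        using zero_less_binomial[of 2 "count_list s j"] by linarith
      then have "real 1 \<le> real (count_list s j choose 2)"
        by (rule of_nat_mono)
      moreover have "0 \<le> real (count_list s j) / real (length s)" by simp
      ultimately show ?thesis
        using pmf_le_1[of "pmf_of_set (plurality_colors s)" j] by linarith
    qed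
  qed
qed

lemma pmf_map_nth_pmf_of_set:
  assumes "x \<noteq> []"
  shows "pmf (map_pmf (\<lambda>v. x ! v) (pmf_of_set {..<length x})) j =
    real (count_list x j) / real (length x)"
proof -
  have "card ({..<length x} \<inter> {v. x ! v = j}) = length (filter ((=) j) x)"
    unfolding length_filter_conv_card by (rule arg_cong[where f=card]) auto
  then show ?thesis
    using assms by (simp add: pmf_map vimage_def measure_pmf_of_set lessThan_empty_iff
        count_list_eq_length_filter)
qed

text \<open>Reading off the colors of uniformly sampled nodes amounts to independent draws from the
  empirical color distribution, to which the moment formulas apply.\<close>

lemma node_update_eq:
  "node_update h x =
    bind_pmf (replicate_pmf h (map_pmf (\<lambda>v. x ! v) (pmf_of_set {..<length x})))
      (\<lambda>s. pmf_of_set (plurality_colors s))"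
proof -
  have "replicate_pmf h (map_pmf (\<lambda>v. x ! v) D) = map_pmf (map (\<lambda>v. x ! v)) (replicate_pmf h D)" for D
    by (induction h) (simp_all add: map_bind_pmf bind_map_pmf)
  then show ?thesis
    by (simp add: node_update_def bind_map_pmf)
qed

text \<open>Taking expectations in \<open>pmf_plurality_colors_le\<close>: the linear term gives
  exactly \<open>p\<close>, and the pairs give \<open>(h choose 2) * p\<^sup>2\<close>.\<close>

lemma pmf_node_update_le:
  fixes x :: "nat list" and j :: nat
  assumes "x \<noteq> []" "0 < h"
  defines "p \<equiv> real (count_list x j) / real (length x)"
  shows "pmf (node_update h x) j \<le> p + (real h)\<^sup>2 * p\<^sup>2 / 2"
proof -
  define D where "D = map_pmf (\<lambda>v. x ! v) (pmf_of_set {..<length x})"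
  have D: "pmf D j = p"
    unfolding D_def p_def by (rule pmf_map_nth_pmf_of_set) fact
  have p: "0 \<le> p" by (simp add: p_def)
  have "ennreal (pmf (node_update h x) j) =
      (\<integral>\<^sup>+s. pmf (pmf_of_set (plurality_colors s)) j \<partial>replicate_pmf h D)"
    unfolding node_update_eq D_def by (rule ennreal_pmf_bind)
  also have "\<dots> \<le> (\<integral>\<^sup>+s. ennreal (1 / real h) * of_nat (count_list s j) +
      of_nat (count_list s j choose 2) \<partial>replicate_pmf h D)"
  proof (rule nn_integral_mono_AE, simp add: AE_measure_pmf_iff set_replicate_pmf, intro allI impI)
    fix s assume s: "s \<in> lists (set_pmf D) \<and> length s = h"
    have "pmf (pmf_of_set (plurality_colors s)) j
        \<le> 1 / real h * real (count_list s j) + real (count_list s j choose 2)"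
      using pmf_plurality_colors_le[of s j] s assms(2) by fastforce
    then show "ennreal (pmf (pmf_of_set (plurality_colors s)) j)
        \<le> ennreal (1 / real h) * of_nat (count_list s j) + of_nat (count_list s j choose 2)"
      by (simp add: ennreal_of_nat_eq_real_of_nat ennreal_mult[symmetric] ennreal_plus[symmetric]
          ennreal_leI del: ennreal_plus)
  qed
  also have "\<dots> = ennreal (1 / real h) * (of_nat h * ennreal p) + of_nat (h choose 2) * ennreal (p\<^sup>2)"
    by (simp add: nn_integral_add nn_integral_cmult nn_integral_count_list_replicate_pmf
        nn_integral_count_list_choose_2_replicate_pmf D)
  also have "\<dots> = ennreal (1 / real h * (real h * p) + real (h choose 2) * p\<^sup>2)"
    using p by (simp add: ennreal_of_nat_eq_real_of_nat ennreal_mult[symmetric] ennreal_plus[symmetric]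
        del: ennreal_plus)
  finally have "pmf (node_update h x) j \<le> 1 / real h * (real h * p) + real (h choose 2) * p\<^sup>2"
    using p by (subst (asm) ennreal_le_iff) auto
  also have "real (h choose 2) \<le> (real h)\<^sup>2 / 2"
  proof -
    have "h choose 2 \<le> h ^ 2 div 2"
      by (simp add: choose_two power2_eq_square div_le_mono)
    then have "2 * (h choose 2) \<le> h ^ 2" by linarith
    then have "real (2 * (h choose 2)) \<le> real (h ^ 2)" by (rule of_nat_mono)
    then show ?thesis by simp
  qed
  then have "1 / real h * (real h * p) + real (h choose 2) * p\<^sup>2 \<le> p + (real h)\<^sup>2 / 2 * p\<^sup>2"
    using assms(2) by (intro add_mono mult_right_mono) auto
  finally show ?thesis by simp
qed

text \<open>The bound on the adoption probability vanishes for a color that no node has, so an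
  absent color cannot appear.\<close>

lemma set_node_update:
  assumes "x \<noteq> []" "0 < h"
  shows "set_pmf (node_update h x) \<subseteq> set x"
proof
  fix j assume "j \<in> set_pmf (node_update h x)"
  then have "0 < pmf (node_update h x) j"
    by (simp add: pmf_positive)
  then have "0 < count_list x j"
    using pmf_node_update_le[OF assms, of j] by (cases "count_list x j = 0") auto
  then show "j \<in> set x"
    by (metis count_list_0_iff less_numeral_extra(3))
qed

section \<open>One round started from a coloring with bounded color fractions\<close>

text \<open>Fixing palette and length makes the set finite, so that events on finitely many rounds
  split into finitely many paths.\<close>

definition bounded_colorings :: "nat \<Rightarrow> nat \<Rightarrow> real \<Rightarrow> nat list set" where
  "bounded_colorings k n b =
    {y. set y \<subseteq> {1..k} \<and> length y = n \<and> (\<forall>j\<in>{1..k}. real (count_list y j) \<le> real n * b)}"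

lemma finite_bounded_colorings: "finite (bounded_colorings k n b)"
  by (rule finite_subset[OF _ finite_lists_length_eq[of "{1..k}" n]]) (auto simp: bounded_colorings_def)

lemma bounded_colorings_mono: "b \<le> b' \<Longrightarrow> bounded_colorings k n b \<subseteq> bounded_colorings k n b'"
  using mult_left_mono[of b b' "real n"] unfolding bounded_colorings_def by fastforce

text \<open>The term \<open>(real h)\<^sup>2 * b\<^sup>2 / 2\<close> absorbs the drift and
  \<open>d\<close> the fluctuation; a union bound over the colors collects the Hoeffding
  errors.\<close>

lemma prob_plurality_round_bounded_colorings_ge:
  assumes y: "y \<in> bounded_colorings k n b" and "0 < n" "0 < h" "0 \<le> d"
  shows "1 - real k * exp (- 2 * real n * d\<^sup>2) \<le> measure_pmf.prob (plurality_round h y)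
    (bounded_colorings k n (b + (real h)\<^sup>2 * b\<^sup>2 / 2 + d))" (is "_ \<le> measure_pmf.prob ?R ?B")
proof -
  let ?D = "node_update h y"
  let ?F = "\<lambda>j. {z. real n * (pmf ?D j + d) \<le> real (count_list z j)}"
  have R: "?R = replicate_pmf n ?D"
    using y by (simp add: bounded_colorings_def plurality_round_def)
  have ne: "y \<noteq> []"
    using y assms(2) by (auto simp: bounded_colorings_def)
  have D: "set_pmf ?D \<subseteq> {1..k}"
    using set_node_update[OF ne \<open>0 < h\<close>] y by (auto simp: bounded_colorings_def)
  have le: "pmf ?D j \<le> b + (real h)\<^sup>2 * b\<^sup>2 / 2" if "j \<in> {1..k}" for j
  proof -
    have frac: "real (count_list y j) / real (length y) \<le> b"
      using y that assms(2) by (simp add: bounded_colorings_def pos_divide_le_eq mult.commute)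
    have "pmf ?D j \<le> real (count_list y j) / real (length y) +
        (real h)\<^sup>2 * (real (count_list y j) / real (length y))\<^sup>2 / 2"
      by (rule pmf_node_update_le[OF ne \<open>0 < h\<close>])
    also have "\<dots> \<le> b + (real h)\<^sup>2 * b\<^sup>2 / 2"
      by (intro add_mono divide_right_mono mult_left_mono power_mono frac) auto
    finally show ?thesis .
  qed
  \<comment> \<open>Palette and length are right almost surely, so on the support a coloring leaves
    \<open>?B\<close> only through a count that is too large.\<close>
  have sub: "z \<in> (\<Union>j\<in>{1..k}. ?F j)" if "z \<in> set_pmf ?R" "z \<notin> ?B" for z
  proof -
    have "set z \<subseteq> {1..k}" "length z = n"
      using that(1) D by (auto simp: R set_replicate_pmf)
    with that(2) obtain j where j: "j \<in> {1..k}"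
      "real n * (b + (real h)\<^sup>2 * b\<^sup>2 / 2 + d) < real (count_list z j)"
      by (auto simp: bounded_colorings_def not_le)
    have "real n * (pmf ?D j + d) \<le> real n * (b + (real h)\<^sup>2 * b\<^sup>2 / 2 + d)"
      by (intro mult_left_mono add_right_mono le j) simp
    then show ?thesis using j by force
  qed
  have "1 - measure_pmf.prob ?R ?B = measure_pmf.prob ?R (- ?B)"
    using measure_pmf.prob_compl[of ?B ?R] by (simp add: Compl_eq_Diff_UNIV)
  also have "\<dots> \<le> measure_pmf.prob ?R (\<Union>j\<in>{1..k}. ?F j)"
    by (rule measure_pmf.finite_measure_mono_AE) (use sub in \<open>auto simp: AE_measure_pmf_iff\<close>)
  also have "\<dots> \<le> (\<Sum>j\<in>{1..k}. measure_pmf.prob ?R (?F j))"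
    by (rule measure_UNION_le) auto
  also have "\<dots> \<le> (\<Sum>j\<in>{1..k}. exp (- 2 * real n * d\<^sup>2))"
    unfolding R by (intro sum_mono prob_count_list_replicate_pmf_ge assms)
  finally show ?thesis by simp
qed

section \<open>Confining the trajectory to prescribed sets of colorings\<close>

text \<open>Splits the event into disjoint cylinders, whose probabilities are explicit. Extensional
  functions in \<open>Pi\<^sub>E\<close> name each finite path exactly once.\<close>

lemma measure_plurality_process_PiE:
  assumes "\<And>s. finite (G s)"
  shows "measure (plurality_process h x) {\<omega>. \<forall>s\<le>t. \<omega> s \<in> G s} =
    (\<Sum>y\<in>Pi\<^sub>E {..t} G. measure (plurality_process h x) {\<omega>. \<forall>s\<le>t. \<omega> s = y s})"
proof -
  interpret prob_space "plurality_process h x" by (rule prob_space_plurality_process)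
  have eq: "{\<omega>. \<forall>s\<le>t. \<omega> s \<in> G s} = (\<Union>y\<in>Pi\<^sub>E {..t} G. {\<omega>. \<forall>s\<le>t. \<omega> s = y s})"
  proof (intro equalityI subsetI)
    fix \<omega> assume "\<omega> \<in> {\<omega>. \<forall>s\<le>t. \<omega> s \<in> G s}"
    then have "restrict \<omega> {..t} \<in> Pi\<^sub>E {..t} G" "\<forall>s\<le>t. \<omega> s = restrict \<omega> {..t} s"
      by auto
    then show "\<omega> \<in> (\<Union>y\<in>Pi\<^sub>E {..t} G. {\<omega>. \<forall>s\<le>t. \<omega> s = y s})" by blast
  qed (auto simp: PiE_iff)
  have "disjoint_family_on (\<lambda>y. {\<omega>. \<forall>s\<le>t. \<omega> s = y s}) (Pi\<^sub>E {..t} G)"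
    unfolding disjoint_family_on_def
  proof (intro ballI impI, rule ccontr)
    fix y z assume yz: "y \<in> Pi\<^sub>E {..t} G" "z \<in> Pi\<^sub>E {..t} G" "y \<noteq> z"
      "{\<omega>. \<forall>s\<le>t. \<omega> s = y s} \<inter> {\<omega>. \<forall>s\<le>t. \<omega> s = z s} \<noteq> {}"
    then have "y s = z s" if "s \<in> {..t}" for s using that by auto
    then have "y = z" using yz by (intro PiE_ext) auto
    with yz show False by simp
  qed
  moreover have "finite (Pi\<^sub>E {..t} G)"
    by (intro finite_PiE assms) auto
  ultimately show ?thesis
    unfolding eq using sets_plurality_path[of "Suc t" _ h x]
    by (intro finite_measure_finite_Union) (auto simp: less_Suc_eq_le)
qed

text \<open>The Markov property, obtained by summing path probabilities: given the path up to
  \<open>t\<close>, the next coloring has law \<open>plurality_round h (y t)\<close>.\<close>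

lemma measure_plurality_process_Suc_ge:
  assumes fin: "\<And>s. finite (G s)"
    and step: "\<And>y. y \<in> G t \<Longrightarrow> 1 - \<delta> \<le> measure_pmf.prob (plurality_round h y) (G (Suc t))"
  shows "(1 - \<delta>) * measure (plurality_process h x) {\<omega>. \<forall>s\<le>t. \<omega> s \<in> G s}
    \<le> measure (plurality_process h x) {\<omega>. \<forall>s\<le>Suc t. \<omega> s \<in> G s}"
proof -
  let ?m = "\<lambda>t y. measure (plurality_process h x) {\<omega>. \<forall>s\<le>t. \<omega> s = y s}"
  have I: "Pi\<^sub>E {..Suc t} G = (\<lambda>(z, y). y(Suc t := z)) ` (G (Suc t) \<times> Pi\<^sub>E {..t} G)"
    by (simp add: atMost_Suc PiE_insert_eq)
  \<comment> \<open>The update at \<open>Suc t\<close> leaves the first \<open>t\<close> transition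
    factors untouched and adds one more.\<close>
  have *: "?m (Suc t) (y(Suc t := z)) = ?m t y * pmf (plurality_round h (y t)) z" for y z
  proof -
    have "(\<Prod>s<t. pmf (plurality_round h ((y(Suc t := z)) s)) ((y(Suc t := z)) (Suc s))) =
        (\<Prod>s<t. pmf (plurality_round h (y s)) (y (Suc s)))"
      by (rule prod.cong) auto
    then show ?thesis
      unfolding measure_plurality_process_path by simp
  qed
  have "(1 - \<delta>) * measure (plurality_process h x) {\<omega>. \<forall>s\<le>t. \<omega> s \<in> G s} =
      (\<Sum>y\<in>Pi\<^sub>E {..t} G. ?m t y * (1 - \<delta>))"
    unfolding measure_plurality_process_PiE[OF fin] by (simp add: sum_distrib_left mult.commute)
  also have "\<dots> \<le> (\<Sum>y\<in>Pi\<^sub>E {..t} G. ?m t y * measure_pmf.prob (plurality_round h (y t)) (G (Suc t)))"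
    by (intro sum_mono mult_left_mono step) auto
  also have "\<dots> = (\<Sum>y\<in>Pi\<^sub>E {..t} G. \<Sum>z\<in>G (Suc t). ?m (Suc t) (y(Suc t := z)))"
    by (simp only: * measure_measure_pmf_finite[OF fin] sum_distrib_left)
  also have "\<dots> = (\<Sum>(z, y)\<in>G (Suc t) \<times> Pi\<^sub>E {..t} G. ?m (Suc t) (y(Suc t := z)))"
    by (subst sum.swap) (simp add: sum.cartesian_product)
  also have "\<dots> = (\<Sum>y\<in>Pi\<^sub>E {..Suc t} G. ?m (Suc t) y)"
    unfolding I by (subst sum.reindex[OF inj_combinator]) (auto intro!: sum.cong simp: case_prod_beta)
  finally show ?thesis
    unfolding measure_plurality_process_PiE[OF fin, of h x "Suc t"] .
qed

text \<open>Each round loses at most \<open>\<delta>\<close>, because the probability of having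
  stayed inside so far is at most 1. This argument does not need
  \<open>\<delta> \<le> 1\<close>.\<close>

lemma measure_plurality_process_ge:
  assumes fin: "\<And>s. finite (G s)" and x: "x \<in> G 0" and "0 \<le> \<delta>"
    and step: "\<And>s y. s < t \<Longrightarrow> y \<in> G s \<Longrightarrow>
      1 - \<delta> \<le> measure_pmf.prob (plurality_round h y) (G (Suc s))"
  shows "1 - real t * \<delta> \<le> measure (plurality_process h x) {\<omega>. \<forall>s\<le>t. \<omega> s \<in> G s}"
  using step
proof (induction t)
  case 0
  interpret prob_space "plurality_process h x" by (rule prob_space_plurality_process)
  \<comment> \<open>The path consisting of the initial coloring alone has an empty product of
    transitions.\<close>
  have "1 = measure (plurality_process h x) {\<omega>. \<forall>s\<le>0. \<omega> s = (\<lambda>_. x) s}"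
    unfolding measure_plurality_process_path by simp
  also have "\<dots> \<le> measure (plurality_process h x) {\<omega>. \<forall>s\<le>0. \<omega> s \<in> G s}"
  proof (rule finite_measure_mono)
    have "{\<omega> \<in> space (plurality_process h x). \<omega> 0 \<in> G 0} \<in> sets (plurality_process h x)"
      by measurable
    then show "{\<omega>. \<forall>s\<le>0. \<omega> s \<in> G s} \<in> sets (plurality_process h x)" by simp
  qed (use x in auto)
  finally show ?case by simp
next
  case (Suc t)
  interpret prob_space "plurality_process h x" by (rule prob_space_plurality_process)
  let ?m = "\<lambda>t. prob {\<omega>. \<forall>s\<le>t. \<omega> s \<in> G s}"
  have "\<delta> * ?m t \<le> \<delta> * 1"
    by (intro mult_left_mono prob_le_1 \<open>0 \<le> \<delta>\<close>)
  moreover have "(1 - \<delta>) * ?m t \<le> ?m (Suc t)"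
    by (rule measure_plurality_process_Suc_ge) (use fin Suc.prems in auto)
  moreover have "1 - real t * \<delta> \<le> ?m t"
    by (rule Suc.IH) (use Suc.prems in auto)
  ultimately show ?case by (simp add: algebra_simps)
qed

section \<open>From bounded fractions to a lower bound on the consensus time\<close>

text \<open>A finite infimum in \<open>enat\<close> is attained, so a finite consensus time is
  itself a monochromatic round.\<close>

lemma consensus_time_geI:
  assumes "\<And>t. monochromatic k n (count_list (\<omega> t)) \<Longrightarrow> a \<le> real t"
  shows "ereal a \<le> ereal_of_enat (consensus_time k n \<omega>)"
proof (cases "consensus_time k n \<omega>")
  case (enat t)
  then have "{enat t | t. monochromatic k n (count_list (\<omega> t))} \<noteq> {}"
    by (auto simp: consensus_time_def Inf_enat_def split: if_splits)
  then have "enat t \<in> {enat t | t. monochromatic k n (count_list (\<omega> t))}"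
    unfolding enat[symmetric] consensus_time_def Inf_enat_def
    by (auto intro: LeastI)
  then show ?thesis using assms enat by auto
qed simp

lemma consensus_time_ge_if_bounded_colorings:
  assumes "0 < n" "b < 1" "\<And>t. real t < a \<Longrightarrow> \<omega> t \<in> bounded_colorings k n b"
  shows "ereal a \<le> ereal_of_enat (consensus_time k n \<omega>)"
proof (rule consensus_time_geI, rule ccontr)
  fix t assume t: "monochromatic k n (count_list (\<omega> t))" "\<not> a \<le> real t"
  then have "real n \<le> real n * b"
    using assms(3)[of t] by (auto simp: monochromatic_def bounded_colorings_def)
  moreover have "real n * b < real n * 1"
    using assms by (intro mult_strict_left_mono) auto
  ultimately show False by simp
qed

text \<open>The allowed fraction \<open>b t\<close> grows by \<open>3 * d\<close> per round,
  \<open>2 * d\<close> for drift and \<open>d\<close> for fluctuation. Up to round \<open>T\<close>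
  it stays at most \<open>7 / (4 * real k)\<close>, which is below 1 since \<open>k\<close> is at
  least 2.\<close>

lemma prob_consensus_time_ge:
  assumes "0 < n" "0 < h" "2 \<le> k" and x: "x \<in> bounded_colorings k n (3 / (2 * real k))"
    and T: "real T \<le> real k / (12 * (real h)\<^sup>2)" "real k / (12 * (real h)\<^sup>2) \<le> real T + 1"
  shows "1 - real T * (real k * exp (- 2 * real n * ((real h)\<^sup>2 / (real k)\<^sup>2)\<^sup>2))
    \<le> measure (plurality_process h x) {\<omega> \<in> space (plurality_process h x).
        ereal_of_enat (consensus_time k n \<omega>) \<ge> ereal (1 / 12 * real k / (real h)\<^sup>2)}"
proof -
  interpret prob_space "plurality_process h x" by (rule prob_space_plurality_process)
  define d where "d = (real h)\<^sup>2 / (real k)\<^sup>2"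
  define b where "b = (\<lambda>t. 3 / (2 * real k) + 3 * real t * d)"
  define G where "G = (\<lambda>t. bounded_colorings k n (b t))"
  have d: "0 \<le> d" by (simp add: d_def)
  have b_le: "b t \<le> 7 / (4 * real k)" if "t \<le> T" for t
  proof -
    \<comment> \<open>With at most \<open>k / (12 h\<^sup>2)\<close> rounds the total growth
      \<open>3 * real t * d\<close> is at most \<open>1 / (4 * real k)\<close>, and 3/2 + 1/4 =
      7/4.\<close>
    have "real t * d \<le> real k / (12 * (real h)\<^sup>2) * d"
      using that T d by (intro mult_right_mono) auto
    also have "\<dots> = 1 / (12 * real k)"
      using assms by (simp add: d_def power2_eq_square)
    finally show ?thesis using assms by (simp add: b_def field_simps)
  qed
  have "1 - real T * (real k * exp (- 2 * real n * d\<^sup>2)) \<le> prob {\<omega>. \<forall>s\<le>T. \<omega> s \<in> G s}"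
  proof (rule measure_plurality_process_ge)
    fix s y assume s: "s < T" "y \<in> G s"
    have "1 - real k * exp (- 2 * real n * d\<^sup>2) \<le> measure_pmf.prob (plurality_round h y)
        (bounded_colorings k n (b s + (real h)\<^sup>2 * (b s)\<^sup>2 / 2 + d))"
      by (rule prob_plurality_round_bounded_colorings_ge) (use s assms d in \<open>auto simp: G_def\<close>)
    also have "\<dots> \<le> measure_pmf.prob (plurality_round h y) (G (Suc s))"
    proof (rule measure_pmf.finite_measure_mono)
      have "(b s)\<^sup>2 \<le> (7 / (4 * real k))\<^sup>2"
        using b_le[of s] s d by (intro power_mono) (auto simp: b_def)
      \<comment> \<open>Here 49/16 is rounded up to 4, so that the drift becomes
        \<open>2 * d\<close>.\<close>
      also have "\<dots> \<le> 4 / (real k)\<^sup>2"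
        by (simp add: power_divide power_mult_distrib divide_simps)
      finally have "(real h)\<^sup>2 * (b s)\<^sup>2 / 2 \<le> (real h)\<^sup>2 * (4 / (real k)\<^sup>2) / 2"
        by (intro divide_right_mono mult_left_mono) auto
      also have "\<dots> = 2 * d" by (simp add: d_def)
      finally have "b s + (real h)\<^sup>2 * (b s)\<^sup>2 / 2 + d \<le> b s + 3 * d" by simp
      also have "\<dots> = b (Suc s)" by (simp add: b_def algebra_simps)
      finally have "b s + (real h)\<^sup>2 * (b s)\<^sup>2 / 2 + d \<le> b (Suc s)" .
      then show "bounded_colorings k n (b s + (real h)\<^sup>2 * (b s)\<^sup>2 / 2 + d) \<subseteq> G (Suc s)"
        unfolding G_def by (rule bounded_colorings_mono)
    qed simp
    finally show "1 - real k * exp (- 2 * real n * d\<^sup>2)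
      \<le> measure_pmf.prob (plurality_round h y) (G (Suc s))" .
  qed (use x in \<open>auto simp: G_def b_def finite_bounded_colorings\<close>)
  also have "\<dots> \<le> prob {\<omega> \<in> space (plurality_process h x).
        ereal_of_enat (consensus_time k n \<omega>) \<ge> ereal (1 / 12 * real k / (real h)\<^sup>2)}"
  proof (rule finite_measure_mono)
    show "{\<omega>. \<forall>s\<le>T. \<omega> s \<in> G s} \<subseteq> {\<omega> \<in> space (plurality_process h x).
        ereal_of_enat (consensus_time k n \<omega>) \<ge> ereal (1 / 12 * real k / (real h)\<^sup>2)}"
    proof (clarsimp, rule consensus_time_ge_if_bounded_colorings)
      fix \<omega> t assume \<omega>: "\<forall>s\<le>T. \<omega> s \<in> G s" and "real t < real k / (12 * (real h)\<^sup>2)"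
      \<comment> \<open>The threshold is at most \<open>real T + 1\<close>, so an integer strictly
        below it is at most \<open>T\<close>.\<close>
      then have "t \<le> T" using T by linarith
      then show "\<omega> t \<in> bounded_colorings k n (7 / (4 * real k))"
        using \<omega> b_le bounded_colorings_mono unfolding G_def by blast
    qed (use assms in auto)
    show "{\<omega> \<in> space (plurality_process h x).
        ereal_of_enat (consensus_time k n \<omega>) \<ge> ereal (1 / 12 * real k / (real h)\<^sup>2)} \<in> events"
      using sets_consensus_time_ge by simp
  qed
  finally show ?thesis unfolding d_def .
qed

section \<open>Asymptotics of the error and conclusion\<close>

text \<open>The exponent is -2 times \<open>n / (k / h) ^ 4\<close>, and the assumption on
  \<open>k / h\<close> makes that quotient at least \<open>n powr (4 * \<epsilon>) / K ^ 4\<close>.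
  The factors \<open>T\<close> and \<open>k\<close> are each at most
  \<open>K\<^sup>2 * n\<close>.\<close>

lemma union_bound_error_le:
  fixes n h k T :: nat and \<epsilon> K :: real
  assumes "0 < n" "0 < h" "0 < k" "0 < K" "0 < \<epsilon>"
    and K: "real k / real h \<le> K * real n powr (1/4 - \<epsilon>)"
    and T: "real T \<le> real k / (12 * (real h)\<^sup>2)"
  shows "real T * (real k * exp (- 2 * real n * ((real h)\<^sup>2 / (real k)\<^sup>2)\<^sup>2))
    \<le> K ^ 4 * (real n)\<^sup>2 * exp (- 2 / K ^ 4 * real n powr (4 * \<epsilon>))"
\<comment> \<open>The assumption bounds only the ratio \<open>k / h\<close>. A nonzero
  \<open>T\<close> forces \<open>h\<^sup>2 \<le> k\<close>, which turns the ratio bound into one on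
  \<open>k\<close> itself; for \<open>T = 0\<close> the left side vanishes.\<close>
proof (cases "T = 0")
  case True
  then show ?thesis by simp
next
  case False
  have "1 \<le> real k / (12 * (real h)\<^sup>2)" using T False by linarith
  then have "12 * (real h)\<^sup>2 \<le> real k"
    using assms(2) by (simp add: pos_le_divide_eq)
  then have hk: "(real h)\<^sup>2 \<le> real k"
    using zero_le_power2[of "real h"] by linarith
  have "real n powr (1/4 - \<epsilon>) \<le> real n powr (1/4)"
    using assms by (intro powr_mono) auto
  then have "(real n powr (1/4 - \<epsilon>)) ^ 2 \<le> (real n powr (1/4)) ^ 2"
    by (intro power_mono) auto
  also have "\<dots> = real n powr (1/2)"
    by (simp add: power2_eq_square powr_add[symmetric])
  also have "\<dots> \<le> real n powr 1"
    using assms by (intro powr_mono) auto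
  finally have n: "(real n powr (1/4 - \<epsilon>))\<^sup>2 \<le> real n" using assms by simp
  \<comment> \<open>Squaring the ratio bound and replacing \<open>h\<^sup>2\<close> by
    \<open>k\<close> lets one factor \<open>k\<close> cancel.\<close>
  have "real k * real k \<le> (K * real n powr (1/4 - \<epsilon>) * real h)\<^sup>2"
    using K assms by (simp add: power2_eq_square[symmetric] pos_divide_le_eq power_mono)
  also have "\<dots> = K\<^sup>2 * (real n powr (1/4 - \<epsilon>))\<^sup>2 * (real h)\<^sup>2"
    by (simp add: power_mult_distrib)
  also have "\<dots> \<le> K\<^sup>2 * real n * real k"
    using n hk by (intro mult_mono) auto
  finally have k: "real k \<le> K\<^sup>2 * real n" using assms by simp
  have "real k / (12 * (real h)\<^sup>2) \<le> real k / 1"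
    using assms by (intro divide_left_mono) (auto simp: Suc_le_eq intro: order_trans[of _ "12 * 1"])
  then have Tk: "real T \<le> K\<^sup>2 * real n" using T k by simp
  have "(real k / real h) ^ 4 \<le> (K * real n powr (1/4 - \<epsilon>)) ^ 4"
    using K by (intro power_mono) auto
  also have "\<dots> = K ^ 4 * real n powr (1 - 4 * \<epsilon>)"
    using assms by (simp add: power_mult_distrib powr_power algebra_simps)
  finally have "real n / (K ^ 4 * real n powr (1 - 4 * \<epsilon>)) \<le> real n / (real k / real h) ^ 4"
    using assms by (intro divide_left_mono) auto
  also have "\<dots> = real n * ((real h)\<^sup>2 / (real k)\<^sup>2)\<^sup>2"
    by (simp add: power_divide)
  also have "real n / (K ^ 4 * real n powr (1 - 4 * \<epsilon>)) = real n powr (4 * \<epsilon>) / K ^ 4"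
    using assms by (simp add: powr_diff field_simps)
  finally have "exp (- 2 * real n * ((real h)\<^sup>2 / (real k)\<^sup>2)\<^sup>2) \<le> exp (- 2 / K ^ 4 * real n powr (4 * \<epsilon>))"
    by simp
  then have "real T * (real k * exp (- 2 * real n * ((real h)\<^sup>2 / (real k)\<^sup>2)\<^sup>2)) \<le>
      K\<^sup>2 * real n * (K\<^sup>2 * real n * exp (- 2 / K ^ 4 * real n powr (4 * \<epsilon>)))"
    using k Tk by (intro mult_mono) auto
  then show ?thesis by (simp add: power2_eq_square power4_eq_xxxx algebra_simps)
qed

text \<open>The color counts sum to the length of the list, which identifies it with
  \<open>n\<close>.\<close>

lemma bounded_colorings_if_realizes:
  assumes "is_configuration k n c" "realizes k x c" "real (Max (c ` {1..k})) \<le> real n * b"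
  shows "x \<in> bounded_colorings k n b"
proof -
  have "length x = (\<Sum>j\<in>{1..k}. count_list x j)"
    using assms(2) by (subst sum_count_set) (auto simp: realizes_def)
  also have "\<dots> = n"
    using assms(1,2) by (simp add: realizes_def is_configuration_def)
  finally have "length x = n" .
  moreover have "real (count_list x j) \<le> real n * b" if "j \<in> {1..k}" for j
  proof -
    have "count_list x j \<le> Max (c ` {1..k})"
      using assms(2) that by (auto simp: realizes_def)
    then show ?thesis using assms(3) by (meson of_nat_mono order_trans)
  qed
  ultimately show ?thesis
    using assms(2) by (simp add: bounded_colorings_def realizes_def)
qed

theorem theorem4p12:
  fixes \<epsilon> K :: real
  assumes "\<epsilon> > 0" and "K > 0"
  shows "\<exists>\<gamma>>0. \<exists>\<alpha>>0. \<exists>n0::nat. \<forall>n\<ge>n0. \<forall>(k::nat) (h::nat) (c::nat \<Rightarrow> nat) (x::nat list).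
    k \<ge> 2 \<longrightarrow> h \<ge> 1 \<longrightarrow>
    real k / real h \<le> K * real n powr (1/4 - \<epsilon>) \<longrightarrow>
    is_configuration k n c \<longrightarrow>
    real (Max (c ` {1..k})) \<le> 3 * real n / (2 * real k) \<longrightarrow>
    realizes k x c \<longrightarrow>
    measure (plurality_process h x)
      {\<omega> \<in> space (plurality_process h x).
         ereal_of_enat (consensus_time k n \<omega>) \<ge> ereal (\<gamma> * real k / (real h)\<^sup>2)}
      \<ge> 1 - real n powr (- \<alpha>)"
proof -
  \<comment> \<open>The stretched exponential beats every polynomial factor, for fixed
    \<open>K\<close> and \<open>\<epsilon>\<close>.\<close>
  have "eventually (\<lambda>n. K ^ 4 * (real n)\<^sup>2 * exp (- 2 / K ^ 4 * real n powr (4 * \<epsilon>)) \<le> real n powr (- 1))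
      sequentially"
    using assms by real_asymp
  then obtain n0 where n0: "\<And>n. n0 \<le> n \<Longrightarrow>
      K ^ 4 * (real n)\<^sup>2 * exp (- 2 / K ^ 4 * real n powr (4 * \<epsilon>)) \<le> real n powr (- 1)"
    unfolding eventually_sequentially by blast
  show ?thesis
  \<comment> \<open>The witnesses are \<gamma> = 1/12, matching the horizon
    \<open>k / (12 h\<^sup>2)\<close>, and \<alpha> = 1, although the superpolynomial decay would
    allow any exponent. \<open>Suc n0\<close> ensures that \<open>n\<close> is positive.\<close>
  proof (rule exI[of _ "1 / 12"], rule conjI, simp, rule exI[of _ 1], rule conjI, simp,
      rule exI[of _ "Suc n0"], intro allI impI)
    fix n k h :: nat and c :: "nat \<Rightarrow> nat" and x :: "nat list"
    assume A: "Suc n0 \<le> n" "2 \<le> k" "1 \<le> h" "real k / real h \<le> K * real n powr (1/4 - \<epsilon>)"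
      "is_configuration k n c" "real (Max (c ` {1..k})) \<le> 3 * real n / (2 * real k)" "realizes k x c"
    define T where "T = nat \<lfloor>real k / (12 * (real h)\<^sup>2)\<rfloor>"
    have "0 \<le> real k / (12 * (real h)\<^sup>2)" by simp
    then have T: "real T \<le> real k / (12 * (real h)\<^sup>2)" "real k / (12 * (real h)\<^sup>2) \<le> real T + 1"
      unfolding T_def by linarith+
    have "real T * (real k * exp (- 2 * real n * ((real h)\<^sup>2 / (real k)\<^sup>2)\<^sup>2))
        \<le> K ^ 4 * (real n)\<^sup>2 * exp (- 2 / K ^ 4 * real n powr (4 * \<epsilon>))"
      by (rule union_bound_error_le) (use A assms T in auto)
    also have "\<dots> \<le> real n powr (- 1)"
      by (rule n0) (use A in simp)
    finally have "1 - real n powr (- 1)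
        \<le> 1 - real T * (real k * exp (- 2 * real n * ((real h)\<^sup>2 / (real k)\<^sup>2)\<^sup>2))"
      by simp
    also have "\<dots> \<le> measure (plurality_process h x) {\<omega> \<in> space (plurality_process h x).
        ereal_of_enat (consensus_time k n \<omega>) \<ge> ereal (1 / 12 * real k / (real h)\<^sup>2)}"
      by (rule prob_consensus_time_ge) (use A T in \<open>auto intro: bounded_colorings_if_realizes\<close>)
    finally show "1 - real n powr (- 1)
        \<le> measure (plurality_process h x) {\<omega> \<in> space (plurality_process h x).
          ereal_of_enat (consensus_time k n \<omega>) \<ge> ereal (1 / 12 * real k / (real h)\<^sup>2)}" .
  qed
qed

end
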